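(* Let $\mathfrak g,\mathfrak h\in \mathbf K\setminus\mathbf G/\mathbf K$ be double cosets and let $g\in\mathfrak g$, $h\in\mathfrak h$ be representatives. For $N\ge 1$ let $f_N:=g\,\mathfrak I(\Theta_N)\,h\in\mathbf G$ and let $\mathfrak f_N:=\mathbf K f_N\mathbf K$. Then: a) The sequence $\mathfrak f_N$ of double cosets is eventually constant. b) The limit (eventual value) $\mathfrak f:=\lim_{N\to\infty}\mathfrak f_N$ does not depend on the choice of the representatives $g\in\mathfrak g$, $h\in\mathfrak h$. c) The product $\mathfrak g\star\mathfrak h:=\mathfrak f$ on $\mathbf K\setminus\mathbf G/\mathbf K$ obtained in this way is associative.
   Context: Let $p$ be a prime, $\alpha\ge 0$ and $k\ge 1$ integers. $\mathbf G=\mathrm{GL}(\alpha+k\infty,\mathbb Q_p)$ is the group of invertible block matrices over $\mathbb Q_p$ of size $(\alpha+\infty+\dots+\infty)\times(\alpha+\infty+\dots+\infty)$ ($k$ copies of $\infty=\mathbb N$) which are finitary, i.e. $g-1$ has only finitely many nonzero entries. $\mathrm O(\infty,\mathbb Z_p)$ is the group of finitary infinite matrices $u$ with entries in $\mathbb Z_p$ preserving the form $\sum v_jw_j$ (i.e. $uu^t=u^tu=1$). The map $\mathfrak I:\mathrm O(\infty,\mathbb Z_p)\to\mathbf G$ is $\mathfrak I(u)=\mathrm{diag}(1_\alpha,u,\dots,u)$ ($k$ copies of $u$), and $\mathbf K:=\mathfrak I(\mathrm O(\infty,\mathbb Z_p))\subset\mathbf G$. Here $\Theta_N\in\mathrm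 O(\infty,\mathbb Z_p)$ is the block matrix of size $N+N+\infty$ $$\Theta_N=\begin{pmatrix}0&1_N&0\\1_N&0&0\\0&0&1_\infty\end{pmatrix}.$$ *)

theory Defs
  imports
    "HOL-Algebra.Coset"
    "HOL-Library.Groups_Big_Fun"
    "HOL-Computational_Algebra.Normalized_Fraction"
    "Berlekamp_Zassenhaus.Finite_Field"
begin

section \<open>The p-adic numbers\<close>

text \<open>
  The prime \<open>p\<close> is \<open>CARD('p)\<close> for a type \<open>'p\<close> of class \<^class>\<open>prime_card\<close>. The ring of p-adic
  integers is the inverse limit of the rings \<open>\<int>/p\<^sup>n\<close>, residue classes being represented by
  integers in \<open>{0..<p\<^sup>n}\<close>; the field of p-adic numbers is its field of fractions.
\<close>

typedef (overloaded) ('p::prime_card) padic_int =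
  "{x :: nat \<Rightarrow> int. \<forall>n. x n \<in> {0..<int CARD('p) ^ n} \<and> x (Suc n) mod int CARD('p) ^ n = x n}"
  morphisms padic_residue Abs_padic_int
  by (rule exI[of _ "\<lambda>_. 0"]) (simp add: prime_card prime_gt_0_nat)

setup_lifting type_definition_padic_int

type_synonym 'p padic = "'p padic_int fract"

lemma mod_power_Suc_mod [simp]: "(a::int) mod (p * p ^ n) mod p ^ n = a mod p ^ n"
  by (simp add: mod_mod_cancel)

lemma padic_residue_mod_Suc:
  "padic_residue (x :: 'p::prime_card padic_int) (Suc n) mod int CARD('p) ^ n = padic_residue x n"
  using padic_residue[of x] by auto

lemma padic_residue_bounds:
  "0 \<le> padic_residue (x :: 'p::prime_card padic_int) n"
  "padic_residue (x :: 'p::prime_card padic_int) n < int CARD('p) ^ n"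
  using padic_residue[of x] by auto

lemma padic_residue_mod_self [simp]:
  "padic_residue (x :: 'p::prime_card padic_int) n mod int CARD('p) ^ n = padic_residue x n"
  by (simp add: padic_residue_bounds)

lemma padic_residue_mod:
  assumes "m \<le> n"
  shows "padic_residue (x :: 'p::prime_card padic_int) n mod int CARD('p) ^ m = padic_residue x m"
  using assms
proof (induction n rule: dec_induct)
  case (step n)
  have "padic_residue x (Suc n) mod int CARD('p) ^ m
      = padic_residue x (Suc n) mod int CARD('p) ^ n mod int CARD('p) ^ m"
    using step.hyps by (simp add: mod_mod_cancel le_imp_power_dvd)
  then show ?case using step.IH by (simp add: padic_residue_mod_Suc)
qed simp

lemma padic_int_closed:
  fixes f :: "nat \<Rightarrow> int"
  assumes "\<And>n. f (Suc n) mod int CARD('p::prime_card) ^ n = f n mod int CARD('p) ^ n"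
  shows "f n mod int CARD('p) ^ n \<in> {0..<int CARD('p) ^ n}
    \<and> f (Suc n) mod int CARD('p) ^ Suc n mod int CARD('p) ^ n = f n mod int CARD('p) ^ n"
  using assms by (auto simp: prime_card prime_gt_0_nat)

instantiation padic_int :: (prime_card) comm_ring_1
begin

lift_definition zero_padic_int :: "'a padic_int" is "\<lambda>_. 0"
  by (simp add: prime_card prime_gt_0_nat)

lift_definition one_padic_int :: "'a padic_int" is "\<lambda>n. 1 mod int CARD('a) ^ n"
  using padic_int_closed[of "\<lambda>_. 1", where 'p='a] by simp

lift_definition plus_padic_int :: "'a padic_int \<Rightarrow> 'a padic_int \<Rightarrow> 'a padic_int"
  is "\<lambda>x y n. (x n + y n) mod int CARD('a) ^ n"
  subgoal premises prems for x y
    by (rule padic_int_closed) (metis prems mod_add_eq)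
  done

lift_definition minus_padic_int :: "'a padic_int \<Rightarrow> 'a padic_int \<Rightarrow> 'a padic_int"
  is "\<lambda>x y n. (x n - y n) mod int CARD('a) ^ n"
  subgoal premises prems for x y
    by (rule padic_int_closed) (metis prems mod_diff_eq)
  done

lift_definition uminus_padic_int :: "'a padic_int \<Rightarrow> 'a padic_int"
  is "\<lambda>x n. (- x n) mod int CARD('a) ^ n"
  subgoal premises prems for x
    by (rule padic_int_closed) (metis prems mod_minus_eq)
  done

lift_definition times_padic_int :: "'a padic_int \<Rightarrow> 'a padic_int \<Rightarrow> 'a padic_int"
  is "\<lambda>x y n. (x n * y n) mod int CARD('a) ^ n"
  subgoal premises prems for x y
    by (rule padic_int_closed) (metis prems mod_mult_eq)
  done

instance
proof
  fix a b c :: "'a padic_int"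
  show "a * b * c = a * (b * c)"
    by transfer (simp add: mod_simps mult.assoc)
  show "a * b = b * a"
    by transfer (simp add: mult.commute)
  show "1 * a = a"
    by transfer (auto simp: mod_simps fun_eq_iff)
  show "a + b + c = a + (b + c)"
    by transfer (simp add: mod_simps add.assoc)
  show "a + b = b + a"
    by transfer (simp add: add.commute)
  show "0 + a = a"
    by transfer (auto simp: fun_eq_iff)
  show "- a + a = 0"
    by transfer (simp add: mod_simps)
  show "a - b = a + - b"
    by transfer (simp add: mod_simps)
  show "(a + b) * c = a * c + b * c"
    by transfer (simp add: mod_simps distrib_right)
  show "(0::'a padic_int) \<noteq> 1"
  proof transfer
    have "1 mod int CARD('a) ^ 1 = 1"
      using prime_gt_1_nat[OF prime_card[where 'a='a]] by simp
    then show "(\<lambda>_. 0) \<noteq> (\<lambda>n. 1 mod int CARD('a) ^ n)"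
      by (metis zero_neq_one)
  qed
qed

end

instance padic_int :: (prime_card) idom
proof
  fix x y :: "'a padic_int"
  assume "x \<noteq> 0" "y \<noteq> 0"
  then obtain a b where a: "padic_residue x a \<noteq> 0" and b: "padic_residue y b \<noteq> 0"
    by (metis ext padic_residue_inject zero_padic_int.rep_eq)
  define p where "p = int CARD('a)"
  have p: "prime_elem p"
    unfolding p_def using prime_card[where 'a='a] by simp
  define u v where "u = padic_residue x (a + b)" and "v = padic_residue y (a + b)"
  have na: "\<not> p ^ a dvd u" and nb: "\<not> p ^ b dvd v"
    using a b padic_residue_mod[of a "a + b" x] padic_residue_mod[of b "a + b" y]
    by (auto simp: u_def v_def p_def dvd_eq_mod_eq_0)
  then have nz: "u \<noteq> 0" "v \<noteq> 0" by auto
  have "multiplicity p u < a" "multiplicity p v < b"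
    using na nb multiplicity_dvd' not_le by blast+
  then have "multiplicity p (u * v) < a + b"
    using nz p by (simp add: prime_elem_multiplicity_mult_distrib)
  then have "\<not> p ^ (a + b) dvd u * v"
    using nz p power_dvd_iff_le_multiplicity[of "u * v" p "a + b"]
    by (auto simp: prime_elem_def)
  then have "padic_residue (x * y) (a + b) \<noteq> 0"
    by (simp add: times_padic_int.rep_eq u_def v_def p_def dvd_eq_mod_eq_0)
  then show "x * y \<noteq> 0"
    by (metis zero_padic_int.rep_eq)
qed


section \<open>Finitary matrices\<close>

text \<open>
  A matrix with rows and columns indexed by a set \<open>I\<close> is a function of two indices vanishing
  outside \<open>I \<times> I\<close>. Products of finitary matrices involve only finite sums, so \<^const>\<open>Sum_any\<close>
  (the sum over all nonzero terms) is the intended sum.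
\<close>

definition mat_unit :: "'i set \<Rightarrow> 'i \<Rightarrow> 'i \<Rightarrow> 'a::comm_ring_1" where
  "mat_unit I = (\<lambda>i j. if i = j \<and> i \<in> I then 1 else 0)"

definition mat_mult :: "('i \<Rightarrow> 'i \<Rightarrow> 'a) \<Rightarrow> ('i \<Rightarrow> 'i \<Rightarrow> 'a) \<Rightarrow> 'i \<Rightarrow> 'i \<Rightarrow> 'a::comm_ring_1" where
  "mat_mult A B = (\<lambda>i j. \<Sum>l. A i l * B l j)"

definition mat_transpose :: "('i \<Rightarrow> 'i \<Rightarrow> 'a) \<Rightarrow> 'i \<Rightarrow> 'i \<Rightarrow> 'a" where
  "mat_transpose A = (\<lambda>i j. A j i)"

definition fin_mats :: "'i set \<Rightarrow> ('i \<Rightarrow> 'i \<Rightarrow> 'a::comm_ring_1) set" where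
  "fin_mats I = {A. (\<forall>i j. i \<notin> I \<or> j \<notin> I \<longrightarrow> A i j = 0) \<and>
                    finite {(i, j). A i j \<noteq> mat_unit I i j}}"

definition fin_mat_monoid :: "'i set \<Rightarrow> ('i \<Rightarrow> 'i \<Rightarrow> 'a::comm_ring_1) monoid" where
  "fin_mat_monoid I = \<lparr>carrier = fin_mats I, monoid.mult = mat_mult, one = mat_unit I\<rparr>"


section \<open>The groups\<close>

text \<open>
  Indices of size \<open>\<alpha> + \<infinity> + \<dots> + \<infinity>\<close> (\<open>k\<close> copies): \<open>Inl a\<close> with \<open>a < \<alpha>\<close>, and \<open>Inr (r, m)\<close>
  for the position \<open>m\<close> in the \<open>r\<close>-th copy, \<open>r < k\<close>. All indices count from 0.
\<close>

type_synonym gl_index = "nat + nat \<times> nat"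
type_synonym 'p gl_mat = "gl_index \<Rightarrow> gl_index \<Rightarrow> 'p padic"

definition gl_indices :: "nat \<Rightarrow> nat \<Rightarrow> gl_index set" where
  "gl_indices \<alpha> k = {..<\<alpha>} <+> ({..<k} \<times> UNIV)"

definition GL_inf :: "nat \<Rightarrow> nat \<Rightarrow> ('p::prime_card) gl_mat monoid" where
  "GL_inf \<alpha> k = units_of (fin_mat_monoid (gl_indices \<alpha> k))"

definition O_inf :: "(nat \<Rightarrow> nat \<Rightarrow> ('p::prime_card) padic_int) set" where
  "O_inf = {u \<in> fin_mats UNIV. mat_mult u (mat_transpose u) = mat_unit UNIV \<and>
                               mat_mult (mat_transpose u) u = mat_unit UNIV}"

definition diag_embed ::
  "nat \<Rightarrow> nat \<Rightarrow> (nat \<Rightarrow> nat \<Rightarrow> ('p::prime_card) padic_int) \<Rightarrow> 'p gl_mat" where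
  "diag_embed \<alpha> k u = (\<lambda>i j. case (i, j) of
      (Inl a, Inl b) \<Rightarrow> if a = b \<and> a < \<alpha> then 1 else 0
    | (Inr (r, m), Inr (s, n)) \<Rightarrow> if r = s \<and> r < k then to_fract (u m n) else 0
    | _ \<Rightarrow> 0)"

definition K_sub :: "nat \<Rightarrow> nat \<Rightarrow> ('p::prime_card) gl_mat set" where
  "K_sub \<alpha> k = diag_embed \<alpha> k ` O_inf"

definition Theta :: "nat \<Rightarrow> nat \<Rightarrow> nat \<Rightarrow> ('p::prime_card) padic_int" where
  "Theta N = (\<lambda>i j. if i < N \<and> j = i + N \<or> j < N \<and> i = j + N \<or> i = j \<and> 2 * N \<le> i
                    then 1 else 0)"


section \<open>Double cosets and their product\<close>

definition dcoset :: "nat \<Rightarrow> nat \<Rightarrow> ('p::prime_card) gl_mat \<Rightarrow> 'p gl_mat set" where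
  "dcoset \<alpha> k g = (K_sub \<alpha> k #>\<^bsub>GL_inf \<alpha> k\<^esub> g) <#>\<^bsub>GL_inf \<alpha> k\<^esub> K_sub \<alpha> k"

definition dcosets :: "nat \<Rightarrow> nat \<Rightarrow> ('p::prime_card) gl_mat set set" where
  "dcosets \<alpha> k = dcoset \<alpha> k ` carrier (GL_inf \<alpha> k)"

definition dcoset_seq ::
  "nat \<Rightarrow> nat \<Rightarrow> ('p::prime_card) gl_mat \<Rightarrow> 'p gl_mat \<Rightarrow> nat \<Rightarrow> 'p gl_mat set" where
  "dcoset_seq \<alpha> k g h N =
     dcoset \<alpha> k (g \<otimes>\<^bsub>GL_inf \<alpha> k\<^esub> diag_embed \<alpha> k (Theta N) \<otimes>\<^bsub>GL_inf \<alpha> k\<^esub> h)"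

definition eventually_constant :: "(nat \<Rightarrow> 'b) \<Rightarrow> bool" where
  "eventually_constant X \<longleftrightarrow> (\<exists>x. eventually (\<lambda>n. X n = x) sequentially)"

definition eventual_value :: "(nat \<Rightarrow> 'b) \<Rightarrow> 'b" where
  "eventual_value X = (THE x. eventually (\<lambda>n. X n = x) sequentially)"

text \<open>The product is computed from an arbitrary choice of representatives.\<close>

definition dcoset_prod ::
  "nat \<Rightarrow> nat \<Rightarrow> ('p::prime_card) gl_mat set \<Rightarrow> 'p gl_mat set \<Rightarrow> 'p gl_mat set" where
  "dcoset_prod \<alpha> k A B =
     eventual_value (dcoset_seq \<alpha> k (SOME g. g \<in> A) (SOME h. h \<in> B))"

end

theory Submission
  imports Defs
begin

text \<open>
  Let \<open>g\<close> and \<open>h\<close> differ from the identity only in the first \<open>n\<close> positions of each infinite block.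
  Both commute with every \<open>\<II>(u)\<close> for which \<open>u\<close> fixes the first \<open>n\<close> basis vectors. Write \<open>\<theta>\<^sub>N\<close> for
  the image of \<open>\<Theta>\<^sub>N\<close>. If \<open>n \<le> N\<close> and \<open>N + n \<le> M\<close>, let \<open>\<rho>\<close> exchange the positions \<open>N + x\<close> and \<open>M + x\<close> for
  \<open>x < n\<close> and put \<open>\<pi> = \<theta>\<^sub>M \<rho> \<theta>\<^sub>N\<close>. Both fix the first \<open>n\<close> positions, and \<open>\<theta>\<^sub>M = \<pi> \<theta>\<^sub>N \<rho>\<close>, so that
  \<open>g \<theta>\<^sub>M h = \<pi> (g \<theta>\<^sub>N h) \<rho>\<close> lies in the double coset of \<open>g \<theta>\<^sub>N h\<close>. Since also \<open>\<theta>\<^sub>N = \<rho> \<theta>\<^sub>M \<pi>\<close>, we get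
  \<open>g \<theta>\<^sub>M h \<theta>\<^sub>N f = \<pi> (g \<theta>\<^sub>N h \<theta>\<^sub>M f) \<pi>\<close>, which is associativity. A factor \<open>v\<close> from \<open>\<^bold>K\<close> between \<open>\<theta>\<^sub>N\<close> and \<open>h\<close>
  is moved to the far left as \<open>\<theta>\<^sub>N v \<theta>\<^sub>N\<close>, which fixes the first \<open>N\<close> positions; likewise a factor
  between \<open>g\<close> and \<open>\<theta>\<^sub>N\<close> is moved to the far right.
\<close>

section \<open>Double cosets in groups with commuting tails\<close>

text \<open>Isolates the group theory from the matrices. \<open>L n\<close> stands for the elements
  that differ from the identity only up to position n of each infinite block, \<open>T n\<close> for
  the elements of \<open>K\<close> that fix those positions. \<open>L_exhaust\<close> is the trace
  left by finitarity, and the element named in \<open>swap\<close> is \<rho>, with \<pi> the product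
  required to lie in \<open>T n\<close>.\<close>

locale tail_group = group G for G (structure) +
  fixes K :: "'a set" and L T :: "nat \<Rightarrow> 'a set" and \<theta> :: "nat \<Rightarrow> 'a"
  assumes K_subgroup: "subgroup K G"
    and L_carrier: "L n \<subseteq> carrier G"
    and L_mono: "m \<le> n \<Longrightarrow> L m \<subseteq> L n"
    and L_exhaust: "x \<in> carrier G \<Longrightarrow> \<exists>n. x \<in> L n"
    and L_mult: "x \<in> L n \<Longrightarrow> y \<in> L n \<Longrightarrow> x \<otimes> y \<in> L n"
    and T_K: "T n \<subseteq> K"
    and T_comm: "t \<in> T n \<Longrightarrow> x \<in> L n \<Longrightarrow> t \<otimes> x = x \<otimes> t"
    and \<theta>_K: "\<theta> N \<in> K"
    and \<theta>_L: "\<theta> N \<in> L (2 * N)"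
    and \<theta>_square: "\<theta> N \<otimes> \<theta> N = \<one>"
    and \<theta>_conj: "x \<in> K \<Longrightarrow> x \<in> L N \<Longrightarrow> \<theta> N \<otimes> x \<otimes> \<theta> N \<in> T N"
    and swap: "n \<le> N \<Longrightarrow> N + n \<le> M \<Longrightarrow>
      \<exists>\<rho>\<in>T n. \<rho> \<otimes> \<rho> = \<one> \<and> \<theta> M \<otimes> \<rho> \<otimes> \<theta> N \<in> T n"
begin

text \<open>This and the next two definitions copy the shape of \<open>dcoset\<close>,
  \<open>dcoset_seq\<close> and \<open>dcoset_prod\<close>, so that after interpretation the notions
  agree by unfolding.\<close>

definition dc :: "'a \<Rightarrow> 'a set" where
  "dc g = (K #> g) <#> K"

definition dc_seq :: "'a \<Rightarrow> 'a \<Rightarrow> nat \<Rightarrow> 'a set" where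
  "dc_seq g h N = dc (g \<otimes> \<theta> N \<otimes> h)"

definition dc_prod :: "'a set \<Rightarrow> 'a set \<Rightarrow> 'a set" where
  "dc_prod A B = eventual_value (dc_seq (SOME g. g \<in> A) (SOME h. h \<in> B))"

lemma K_carrier [simp]: "x \<in> K \<Longrightarrow> x \<in> carrier G"
  by (rule subgroup.mem_carrier[OF K_subgroup])

lemma T_in_K [simp]: "x \<in> T n \<Longrightarrow> x \<in> K"
  by (rule subsetD[OF T_K])

lemma T_carrier [simp]: "x \<in> T n \<Longrightarrow> x \<in> carrier G"
  by (rule K_carrier[OF T_in_K])

lemma L_carrier' [simp]: "x \<in> L n \<Longrightarrow> x \<in> carrier G"
  by (rule subsetD[OF L_carrier])

lemma \<theta>_carrier [simp]: "\<theta> N \<in> carrier G"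
  by (simp add: \<theta>_K)

lemma mem_dc: "x \<in> dc g \<longleftrightarrow> (\<exists>a\<in>K. \<exists>b\<in>K. x = a \<otimes> g \<otimes> b)"
  unfolding dc_def r_coset_def set_mult_def by blast

lemma dc_mult:
  assumes g: "g \<in> carrier G" and a: "a \<in> K" and b: "b \<in> K"
  shows "dc (a \<otimes> g \<otimes> b) = dc g"
proof -
  have sub: "dc (a \<otimes> g \<otimes> b) \<subseteq> dc g" if "g \<in> carrier G" "a \<in> K" "b \<in> K" for a g b
  proof
    fix x assume "x \<in> dc (a \<otimes> g \<otimes> b)"
    then obtain c d where cd: "c \<in> K" "d \<in> K" and "x = c \<otimes> (a \<otimes> g \<otimes> b) \<otimes> d"
      unfolding mem_dc by blast
    then have "x = (c \<otimes> a) \<otimes> g \<otimes> (b \<otimes> d)" using that by (simp add: m_assoc)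
    then show "x \<in> dc g"
      unfolding mem_dc using cd that subgroup.m_closed[OF K_subgroup] by blast
  qed
  have inv: "inv a \<in> K" "inv b \<in> K"
    using a b K_subgroup by (auto simp: subgroup.m_inv_closed)
  \<comment> \<open>The reverse inclusion is the first one again, for the multipliers
    \<open>inv a\<close> and \<open>inv b\<close>.\<close>
  have "g = inv a \<otimes> (a \<otimes> g \<otimes> b) \<otimes> inv b"
    using g a b by (simp add: m_assoc) (simp add: m_assoc[symmetric])
  then have "dc g \<subseteq> dc (a \<otimes> g \<otimes> b)"
    using sub[of "a \<otimes> g \<otimes> b" "inv a" "inv b"] g a b inv by simp
  then show ?thesis using sub[OF assms] by blast
qed

lemma dc_self: "g \<in> carrier G \<Longrightarrow> g \<in> dc g"
  unfolding mem_dc using subgroup.one_closed[OF K_subgroup] by force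

lemma \<theta>_cancel [simp]: "x \<in> carrier G \<Longrightarrow> \<theta> N \<otimes> (\<theta> N \<otimes> x) = x"
  by (simp add: m_assoc[symmetric] \<theta>_square)

lemma T_comm_left:
  "t \<in> T n \<Longrightarrow> x \<in> L n \<Longrightarrow> y \<in> carrier G \<Longrightarrow> t \<otimes> (x \<otimes> y) = x \<otimes> (t \<otimes> y)"
  using T_comm[of t n x] by (simp add: m_assoc[symmetric])

text \<open>With \<pi> the product supplied by \<open>swap\<close>, both formulas are cancellations
  of squares. The first moves a single \<theta> outwards; the second is what lets associativity
  trade one \<theta> for the other.\<close>

lemma swap_obtain:
  assumes "n \<le> N" "N + n \<le> M"
  obtains \<rho> \<pi> where "\<rho> \<in> T n" "\<pi> \<in> T n" "\<rho> \<otimes> \<rho> = \<one>"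
    "\<theta> M = \<pi> \<otimes> \<theta> N \<otimes> \<rho>" "\<theta> N = \<rho> \<otimes> \<theta> M \<otimes> \<pi>"
proof -
  obtain \<rho> where \<rho>: "\<rho> \<in> T n" "\<rho> \<otimes> \<rho> = \<one>" "\<theta> M \<otimes> \<rho> \<otimes> \<theta> N \<in> T n"
    using swap[OF assms] by blast
  have "\<theta> M = (\<theta> M \<otimes> \<rho> \<otimes> \<theta> N) \<otimes> \<theta> N \<otimes> \<rho>"
    using \<rho> by (simp add: m_assoc)
  moreover have "\<theta> N = \<rho> \<otimes> \<theta> M \<otimes> (\<theta> M \<otimes> \<rho> \<otimes> \<theta> N)"
    using \<rho> by (simp add: m_assoc) (simp add: m_assoc[symmetric])
  ultimately show ?thesis using that \<rho> by blast
qed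

section \<open>Stabilisation of the sequence of double cosets\<close>

lemma dc_\<theta>_far:
  assumes "g \<in> L n" "h \<in> L n" "n \<le> N" "N + n \<le> M"
  shows "dc (g \<otimes> \<theta> M \<otimes> h) = dc (g \<otimes> \<theta> N \<otimes> h)"
proof -
  obtain \<rho> \<pi> where *: "\<rho> \<in> T n" "\<pi> \<in> T n" "\<theta> M = \<pi> \<otimes> \<theta> N \<otimes> \<rho>"
    using swap_obtain[OF assms(3,4)] by blast
  have "g \<otimes> \<theta> M \<otimes> h = g \<otimes> (\<pi> \<otimes> (\<theta> N \<otimes> (\<rho> \<otimes> h)))"
    using * assms by (simp add: m_assoc)
  also have "\<dots> = \<pi> \<otimes> (g \<otimes> \<theta> N \<otimes> h) \<otimes> \<rho>"
    using * assms
    by (simp add: T_comm_left[OF *(2) assms(1)] T_comm[OF *(1) assms(2)] m_assoc)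
  finally have "g \<otimes> \<theta> M \<otimes> h = \<pi> \<otimes> (g \<otimes> \<theta> N \<otimes> h) \<otimes> \<rho>" .
  moreover have "dc (\<pi> \<otimes> (g \<otimes> \<theta> N \<otimes> h) \<otimes> \<rho>) = dc (g \<otimes> \<theta> N \<otimes> h)"
    using * assms by (intro dc_mult) auto
  ultimately show ?thesis by (simp only:)
qed

text \<open>The swap needs a gap of n between the two indices, which N and n may lack. Both are
  therefore compared with N + n, which is far enough from either.\<close>

lemma dc_seq_const:
  assumes "g \<in> L n" "h \<in> L n" "n \<le> N"
  shows "dc_seq g h N = dc_seq g h n"
  using dc_\<theta>_far[of g n h n "N + n"] dc_\<theta>_far[of g n h N "N + n"] assms
  by (simp add: dc_seq_def)

lemma eventual_value_eq:
  assumes "eventually (\<lambda>n. X n = x) sequentially"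
  shows "eventual_value X = x"
  unfolding eventual_value_def
proof (rule the_equality)
  show "eventually (\<lambda>n. X n = x) sequentially" by (rule assms)
  fix y assume "eventually (\<lambda>n. X n = y) sequentially"
  with assms have "eventually (\<lambda>n::nat. x = y) sequentially"
    by eventually_elim simp
  then show "y = x" by simp
qed

lemma eventually_dc_seq:
  assumes "g \<in> L n" "h \<in> L n"
  shows "eventually (\<lambda>N. dc_seq g h N = dc_seq g h n) sequentially"
  using dc_seq_const[OF assms] eventually_sequentially by blast

text \<open>The limit is already attained at any level containing both representatives, so later
  computations may pick one level for all the data.\<close>

lemma eventual_value_dc_seq:
  "g \<in> L n \<Longrightarrow> h \<in> L n \<Longrightarrow> eventual_value (dc_seq g h) = dc (g \<otimes> \<theta> n \<otimes> h)"
  by (metis eventual_value_eq eventually_dc_seq dc_seq_def)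

text \<open>The levels form an increasing chain exhausting the group.\<close>

lemma common_level:
  assumes "finite X" "X \<subseteq> carrier G"
  shows "\<exists>n. X \<subseteq> L n"
  using assms
proof (induction X)
  case (insert x X)
  then obtain n where "X \<subseteq> L n" by auto
  moreover obtain m where "x \<in> L m" using L_exhaust insert.prems by auto
  ultimately have "insert x X \<subseteq> L (max m n)"
    using L_mono[of m "max m n"] L_mono[of n "max m n"] by auto
  then show ?case by blast
qed auto

lemma eventually_constant_dc_seq:
  assumes "g \<in> carrier G" "h \<in> carrier G"
  shows "eventually_constant (dc_seq g h)"
proof -
  obtain n where "g \<in> L n" "h \<in> L n" using common_level[of "{g, h}"] assms by auto
  then show ?thesis unfolding eventually_constant_def using eventually_dc_seq by blast
qed

section \<open>Independence of the representatives\<close>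

lemma eventual_value_indep:
  assumes "g \<in> carrier G" "h \<in> carrier G" "g' \<in> dc g" "h' \<in> dc h"
  shows "eventual_value (dc_seq g' h') = eventual_value (dc_seq g h)"
proof -
  obtain a u where g': "a \<in> K" "u \<in> K" "g' = a \<otimes> g \<otimes> u"
    using assms by (auto simp: mem_dc)
  obtain v b where h': "v \<in> K" "b \<in> K" "h' = v \<otimes> h \<otimes> b"
    using assms by (auto simp: mem_dc)
  \<comment> \<open>The inner factors u and v must lie in the level for
    \<open>\<theta>_conj\<close>; g' and h' must lie there so that their limit too is read off at
    n.\<close>
  have "\<exists>n. {g, h, u, v, g', h'} \<subseteq> L n"
    using assms g' h' by (intro common_level) auto
  then obtain n where n: "g \<in> L n" "h \<in> L n" "u \<in> L n" "v \<in> L n" "g' \<in> L n" "h' \<in> L n"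
    by auto
  define u' v' where "u' = \<theta> n \<otimes> u \<otimes> \<theta> n" and "v' = \<theta> n \<otimes> v \<otimes> \<theta> n"
  have T: "u' \<in> T n" "v' \<in> T n"
    using \<theta>_conj g' h' n by (auto simp: u'_def v'_def)
  have eq: "u \<otimes> \<theta> n = \<theta> n \<otimes> u'" "\<theta> n \<otimes> v = v' \<otimes> \<theta> n"
    using n by (simp_all add: u'_def v'_def m_assoc \<theta>_square)
  \<comment> \<open>First v crosses \<theta> and leaves to the left as v', passing u and g. Only
    then does u cross \<theta> and leave to the right as u', passing h.\<close>
  have "g' \<otimes> \<theta> n \<otimes> h' = a \<otimes> (g \<otimes> (u \<otimes> ((\<theta> n \<otimes> v) \<otimes> (h \<otimes> b))))"
    using n g' h' by (simp add: m_assoc)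
  also have "\<dots> = a \<otimes> (g \<otimes> (u \<otimes> (v' \<otimes> (\<theta> n \<otimes> (h \<otimes> b)))))"
    unfolding eq using n g' h' T by (simp add: m_assoc)
  also have "\<dots> = a \<otimes> (v' \<otimes> (g \<otimes> ((u \<otimes> \<theta> n) \<otimes> (h \<otimes> b))))"
    using n g' h' T
    by (simp add: T_comm_left[OF T(2) n(1)] T_comm_left[OF T(2) n(3)] m_assoc)
  also have "\<dots> = a \<otimes> (v' \<otimes> (g \<otimes> (\<theta> n \<otimes> (u' \<otimes> (h \<otimes> b)))))"
    unfolding eq using n g' h' T by (simp add: m_assoc)
  also have "\<dots> = (a \<otimes> v') \<otimes> (g \<otimes> \<theta> n \<otimes> h) \<otimes> (u' \<otimes> b)"
    using n g' h' T by (simp add: T_comm_left[OF T(1) n(2)] m_assoc)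
  finally have "g' \<otimes> \<theta> n \<otimes> h' = (a \<otimes> v') \<otimes> (g \<otimes> \<theta> n \<otimes> h) \<otimes> (u' \<otimes> b)" .
  moreover have "dc ((a \<otimes> v') \<otimes> (g \<otimes> \<theta> n \<otimes> h) \<otimes> (u' \<otimes> b)) = dc (g \<otimes> \<theta> n \<otimes> h)"
    using n g' h' T by (intro dc_mult subgroup.m_closed[OF K_subgroup]) auto
  ultimately have "dc (g' \<otimes> \<theta> n \<otimes> h') = dc (g \<otimes> \<theta> n \<otimes> h)" by (simp only:)
  then show ?thesis using n by (simp add: eventual_value_dc_seq)
qed

section \<open>The product of double cosets and its associativity\<close>

lemma dc_carrier: "g \<in> carrier G \<Longrightarrow> x \<in> dc g \<Longrightarrow> x \<in> carrier G"
  by (auto simp: mem_dc)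

text \<open>The representatives chosen by \<open>SOME\<close> lie in the double cosets, so
  independence replaces them by g and h.\<close>

lemma dc_prod_dc:
  assumes "g \<in> L n" "h \<in> L n"
  shows "dc_prod (dc g) (dc h) = dc (g \<otimes> \<theta> n \<otimes> h)"
proof -
  have "(SOME x. x \<in> dc y) \<in> dc y" if "y \<in> carrier G" for y
    using dc_self[OF that] by (rule someI)
  then have "dc_prod (dc g) (dc h) = eventual_value (dc_seq g h)"
    unfolding dc_prod_def using assms by (intro eventual_value_indep) auto
  then show ?thesis using assms by (simp add: eventual_value_dc_seq)
qed

lemma dc_prod_closed:
  assumes "A \<in> dc ` carrier G" "B \<in> dc ` carrier G"
  shows "dc_prod A B \<in> dc ` carrier G"
proof -
  obtain g h where gh: "g \<in> carrier G" "h \<in> carrier G" "A = dc g" "B = dc h"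
    using assms by auto
  then obtain n where "g \<in> L n" "h \<in> L n" using common_level[of "{g, h}"] by auto
  then show ?thesis using gh by (auto simp: dc_prod_dc)
qed

text \<open>
  Both bracketings have the form \<open>g \<sigma> h \<tau> f\<close>, with \<open>(\<sigma>, \<tau>)\<close> equal to \<open>(\<theta> n, \<theta> (2n))\<close> and
  \<open>(\<theta> (2n), \<theta> n)\<close>. One \<open>\<rho>\<close>, moved through \<open>h\<close>, converts both factors simultaneously.
\<close>

lemma dc_prod_assoc:
  assumes "A \<in> dc ` carrier G" "B \<in> dc ` carrier G" "C \<in> dc ` carrier G"
  shows "dc_prod (dc_prod A B) C = dc_prod A (dc_prod B C)"
proof -
  obtain g h f where ghf: "g \<in> carrier G" "h \<in> carrier G" "f \<in> carrier G"
    "A = dc g" "B = dc h" "C = dc f"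
    using assms by auto
  then obtain n where n: "g \<in> L n" "h \<in> L n" "f \<in> L n"
    using common_level[of "{g, h, f}"] by auto
  \<comment> \<open>The inner product contains \<open>\<theta> n\<close>, which has level 2n; hence
    the outer product is evaluated at 2n. The gap between n and 2n is exactly what the swap
    requires.\<close>
  then have n2: "g \<in> L (2 * n)" "h \<in> L (2 * n)" "f \<in> L (2 * n)"
    using L_mono[of n "2 * n"] by auto
  have left: "dc_prod (dc_prod A B) C = dc (g \<otimes> \<theta> n \<otimes> h \<otimes> \<theta> (2 * n) \<otimes> f)"
    using n n2 ghf by (simp add: dc_prod_dc[of _ n]) (intro dc_prod_dc L_mult \<theta>_L)
  have right: "dc_prod A (dc_prod B C) = dc (g \<otimes> \<theta> (2 * n) \<otimes> (h \<otimes> \<theta> n \<otimes> f))"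
    using n n2 ghf by (simp add: dc_prod_dc[of _ n]) (intro dc_prod_dc L_mult \<theta>_L)
  obtain \<rho> \<pi> where \<rho>\<pi>: "\<rho> \<in> T n" "\<pi> \<in> T n" and \<rho>_square: "\<rho> \<otimes> \<rho> = \<one>"
    and M: "\<theta> (2 * n) = \<pi> \<otimes> \<theta> n \<otimes> \<rho>" and N: "\<theta> n = \<rho> \<otimes> \<theta> (2 * n) \<otimes> \<pi>"
    using swap_obtain[of n n "2 * n"] by auto
  have \<rho>_cancel: "\<rho> \<otimes> (\<rho> \<otimes> x) = x" if "x \<in> carrier G" for x
    using \<rho>\<pi> that by (simp add: m_assoc[symmetric] \<rho>_square)
  have "g \<otimes> \<theta> (2 * n) \<otimes> (h \<otimes> \<theta> n \<otimes> f)
      = (g \<otimes> (\<pi> \<otimes> \<theta> n \<otimes> \<rho>)) \<otimes> (h \<otimes> (\<rho> \<otimes> \<theta> (2 * n) \<otimes> \<pi>) \<otimes> f)"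
    by (simp only: M[symmetric] N[symmetric])
  also have "\<dots> = \<pi> \<otimes> (g \<otimes> (\<theta> n \<otimes> (\<rho> \<otimes> (\<rho> \<otimes> (h \<otimes> (\<theta> (2 * n) \<otimes> f)))))) \<otimes> \<pi>"
    using n \<rho>\<pi>
    by (simp add: m_assoc T_comm_left[OF \<rho>\<pi>(2) n(1)] T_comm_left[OF \<rho>\<pi>(1) n(2)]
        T_comm[OF \<rho>\<pi>(2) n(3)])
  also have "\<dots> = \<pi> \<otimes> (g \<otimes> \<theta> n \<otimes> h \<otimes> \<theta> (2 * n) \<otimes> f) \<otimes> \<pi>"
    using n \<rho>\<pi> by (simp add: \<rho>_cancel m_assoc)
  finally have "g \<otimes> \<theta> (2 * n) \<otimes> (h \<otimes> \<theta> n \<otimes> f)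
    = \<pi> \<otimes> (g \<otimes> \<theta> n \<otimes> h \<otimes> \<theta> (2 * n) \<otimes> f) \<otimes> \<pi>" .
  moreover have "dc (\<pi> \<otimes> (g \<otimes> \<theta> n \<otimes> h \<otimes> \<theta> (2 * n) \<otimes> f) \<otimes> \<pi>)
    = dc (g \<otimes> \<theta> n \<otimes> h \<otimes> \<theta> (2 * n) \<otimes> f)"
    using n \<rho>\<pi> by (intro dc_mult) auto
  ultimately show ?thesis unfolding left right by (simp only:)
qed

end

section \<open>Finitary matrices\<close>

text \<open>A square block on F completed by the identity of I. F may be infinite, which is how
  tails are described; for F inside I the entries outside I are forced to vanish.\<close>

definition supported :: "'i set \<Rightarrow> 'i set \<Rightarrow> ('i \<Rightarrow> 'i \<Rightarrow> 'a::comm_ring_1) \<Rightarrow> bool" where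
  "supported I F A \<longleftrightarrow> (\<forall>i j. i \<notin> F \<or> j \<notin> F \<longrightarrow> A i j = mat_unit I i j)"

lemma supportedD: "supported I F A \<Longrightarrow> i \<notin> F \<or> j \<notin> F \<Longrightarrow> A i j = mat_unit I i j"
  by (simp add: supported_def)

lemma supported_nonzero: "supported I F A \<Longrightarrow> A i j \<noteq> 0 \<Longrightarrow> i \<noteq> j \<Longrightarrow> i \<in> F \<and> j \<in> F"
  unfolding supported_def mat_unit_def by metis

lemma supported_mono: "supported I F A \<Longrightarrow> F \<subseteq> E \<Longrightarrow> supported I E A"
  unfolding supported_def by blast

lemma supported_mat_unit: "supported I F (mat_unit I)"
  by (simp add: supported_def)

text \<open>Finitely many exceptional entries occupy finitely many rows and columns; these rows and
  columns together form the block.\<close>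

lemma fin_mats_supported:
  "A \<in> fin_mats I \<longleftrightarrow> (\<exists>F. finite F \<and> F \<subseteq> I \<and> supported I F A)"
proof
  assume A: "A \<in> fin_mats I"
  define D where "D = {(i, j). A i j \<noteq> mat_unit I i j}"
  have "finite D" using A by (simp add: fin_mats_def D_def)
  moreover have "supported I (I \<inter> (fst ` D \<union> snd ` D)) A"
    unfolding supported_def
  proof (intro allI impI)
    fix i j
    assume ij: "i \<notin> I \<inter> (fst ` D \<union> snd ` D) \<or> j \<notin> I \<inter> (fst ` D \<union> snd ` D)"
    show "A i j = mat_unit I i j"
    proof (cases "i \<in> I \<and> j \<in> I")
      case True
      then have "(i, j) \<notin> D" using ij by (metis IntI UnI1 UnI2 fst_conv image_eqI snd_conv)
      then show ?thesis by (simp add: D_def)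
    next
      case False
      then show ?thesis using A by (auto simp: fin_mats_def mat_unit_def)
    qed
  qed
  ultimately show "\<exists>F. finite F \<and> F \<subseteq> I \<and> supported I F A"
    by (intro exI[of _ "I \<inter> (fst ` D \<union> snd ` D)"]) auto
next
  assume "\<exists>F. finite F \<and> F \<subseteq> I \<and> supported I F A"
  then obtain F where F: "finite F" "F \<subseteq> I" "supported I F A" by blast
  have "{(i, j). A i j \<noteq> mat_unit I i j} \<subseteq> F \<times> F"
    using F(3) by (auto simp: supported_def)
  then have "finite {(i, j). A i j \<noteq> mat_unit I i j}"
    using F(1) by (meson finite_SigmaI finite_subset)
  moreover have "A i j = 0" if "i \<notin> I \<or> j \<notin> I" for i j
    using that supportedD[OF F(3)] subsetD[OF F(2)] unfolding mat_unit_def by metis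
  ultimately show "A \<in> fin_mats I" by (simp add: fin_mats_def)
qed

lemma fin_mats_outside: "A \<in> fin_mats I \<Longrightarrow> i \<notin> I \<or> j \<notin> I \<Longrightarrow> A i j = 0"
  by (simp add: fin_mats_def)

text \<open>Row i of A vanishes outside F and the diagonal position, which is why S must contain
  i.\<close>

lemma mat_mult_sum:
  assumes "finite S" "F \<subseteq> S" "i \<in> S" "supported I F A"
  shows "mat_mult A B i j = (\<Sum>l\<in>S. A i l * B l j)"
  unfolding mat_mult_def
proof (rule Sum_any.expand_superset[OF assms(1)], safe)
  fix l assume "A i l * B l j \<noteq> 0"
  then have "A i l \<noteq> 0" by auto
  then show "l \<in> S"
    using assms supported_nonzero[OF assms(4), of i l] by auto
qed

text \<open>A local unit law: B has to look like the unit matrix only in column j, at the rows that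
  row i of A reaches. The next lemma is its mirror image.\<close>

lemma mat_mult_right_unit:
  assumes "\<And>l. A i l \<noteq> 0 \<Longrightarrow> B l j = mat_unit I l j"
  shows "mat_mult A B i j = (if j \<in> I then A i j else 0)"
proof -
  have "A i l * B l j = (if l = j then (if j \<in> I then A i j else 0) else 0)" for l
    using assms[of l] by (cases "A i l = 0") (auto simp: mat_unit_def)
  then show ?thesis by (simp add: mat_mult_def)
qed

lemma mat_mult_left_unit:
  assumes "\<And>l. B l j \<noteq> 0 \<Longrightarrow> A i l = mat_unit I i l"
  shows "mat_mult A B i j = (if i \<in> I then B i j else 0)"
proof -
  have "A i l * B l j = (if i = l then (if i \<in> I then B i j else 0) else 0)" for l
    using assms[of l] by (cases "B l j = 0") (auto simp: mat_unit_def)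
  then show ?thesis by (simp add: mat_mult_def)
qed

text \<open>For a row outside F the left factor acts as the unit; otherwise the column is outside F
  and the right factor does.\<close>

lemma supported_mult:
  assumes A: "supported I F A" and B: "supported I F B"
  shows "supported I F (mat_mult A B)"
  unfolding supported_def
proof (intro allI impI)
  fix i j assume ij: "i \<notin> F \<or> j \<notin> F"
  show "mat_mult A B i j = mat_unit I i j"
  proof (cases "i \<in> F")
    case True
    then show ?thesis using ij supportedD[OF A] supportedD[OF B]
      by (subst mat_mult_right_unit[where I = I]) (auto simp: mat_unit_def)
  next
    case False
    then show ?thesis using ij supportedD[OF A] supportedD[OF B]
      by (subst mat_mult_left_unit[where I = I]) (auto simp: mat_unit_def)
  qed
qed

lemma mat_mult_assoc:
  assumes "A \<in> fin_mats I" "B \<in> fin_mats I"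
  shows "mat_mult (mat_mult A B) C = mat_mult A (mat_mult B C)"
proof (intro ext)
  fix i j
  obtain E F where E: "finite E" "supported I E A" and F: "finite F" "supported I F B"
    using assms by (auto simp: fin_mats_supported)
  \<comment> \<open>One finite index set for all the sums: each is confined by its left factor, and
    i accounts for the diagonal entry of the outer row.\<close>
  define S where "S = insert i (E \<union> F)"
  have S: "finite S" "E \<subseteq> S" "F \<subseteq> S" "E \<union> F \<subseteq> S" "i \<in> S" using E F by (auto simp: S_def)
  have "supported I (E \<union> F) (mat_mult A B)"
    using E F by (intro supported_mult) (auto elim: supported_mono)
  then have "mat_mult (mat_mult A B) C i j = (\<Sum>l\<in>S. (\<Sum>m\<in>S. A i m * B m l) * C l j)"
    using S E F by (simp add: mat_mult_sum[of S "E \<union> F"] mat_mult_sum[of S E])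
  also have "\<dots> = (\<Sum>l\<in>S. \<Sum>m\<in>S. A i m * B m l * C l j)"
    by (simp add: sum_distrib_right)
  also have "\<dots> = (\<Sum>m\<in>S. \<Sum>l\<in>S. A i m * B m l * C l j)"
    by (rule sum.swap)
  also have "\<dots> = (\<Sum>m\<in>S. A i m * mat_mult B C m j)"
    using S F by (simp add: mat_mult_sum[of S F] sum_distrib_left mult.assoc)
  also have "\<dots> = mat_mult A (mat_mult B C) i j"
    using S E by (simp add: mat_mult_sum[of S E])
  finally show "mat_mult (mat_mult A B) C i j = mat_mult A (mat_mult B C) i j" .
qed

lemma supported_disjoint_commute:
  assumes A: "supported I F A" and B: "supported I E B" and "F \<inter> E = {}"
    and A0: "\<And>i j. i \<notin> I \<or> j \<notin> I \<Longrightarrow> A i j = 0"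
    and B0: "\<And>i j. i \<notin> I \<or> j \<notin> I \<Longrightarrow> B i j = 0"
  shows "mat_mult A B = mat_mult B A"
proof -
  \<comment> \<open>In a row outside F, A acts as the unit, and B leads from there only to indices
    outside F, so both products equal B. A row in F lies outside E, so the claim is stated for
    arbitrary A, B, E, F and reused with the roles exchanged.\<close>
  have *: "mat_mult A B i j = mat_mult B A i j"
    if A: "supported I F A" and B: "supported I E B" and "F \<inter> E = {}" "i \<notin> F"
      and B0: "\<And>i j. i \<notin> I \<or> j \<notin> I \<Longrightarrow> B i j = 0" for A B F E i j
  proof -
    have "mat_mult A B i j = (if i \<in> I then B i j else 0)"
      using supportedD[OF A] that(4) by (intro mat_mult_left_unit) auto
    moreover have "mat_mult B A i j = (if j \<in> I then B i j else 0)"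
    proof (rule mat_mult_right_unit)
      fix l assume "B i l \<noteq> 0"
      then have "l \<notin> F"
        using supported_nonzero[OF B, of i l] that(3,4) by auto
      then show "A l j = mat_unit I l j" using supportedD[OF A] by blast
    qed
    ultimately show ?thesis using B0 by auto
  qed
  show ?thesis
  proof (intro ext)
    fix i j show "mat_mult A B i j = mat_mult B A i j"
    proof (cases "i \<in> F")
      case False
      then show ?thesis using * assms by blast
    next
      case True
      then have "mat_mult B A i j = mat_mult A B i j" using assms by (intro *[OF B A]) auto
      then show ?thesis by simp
    qed
  qed
qed

lemma fin_mats_mult:
  assumes "A \<in> fin_mats I" "B \<in> fin_mats I"
  shows "mat_mult A B \<in> fin_mats I"
proof -
  obtain E F where "finite E" "E \<subseteq> I" "supported I E A" "finite F" "F \<subseteq> I" "supported I F B"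
    using assms by (auto simp: fin_mats_supported)
  then have "supported I (E \<union> F) (mat_mult A B)"
    by (intro supported_mult) (auto elim: supported_mono)
  then show ?thesis
    using \<open>finite E\<close> \<open>finite F\<close> \<open>E \<subseteq> I\<close> \<open>F \<subseteq> I\<close> unfolding fin_mats_supported
    by (intro exI[of _ "E \<union> F"]) auto
qed

lemma mat_unit_fin_mats: "mat_unit I \<in> fin_mats I"
  unfolding fin_mats_supported by (intro exI[of _ "{}"]) (simp add: supported_mat_unit)

lemma mat_mult_unit_left: "A \<in> fin_mats I \<Longrightarrow> mat_mult (mat_unit I) A = A"
  by (intro ext) (subst mat_mult_left_unit[where I = I], auto dest: fin_mats_outside)

lemma mat_mult_unit_right: "A \<in> fin_mats I \<Longrightarrow> mat_mult A (mat_unit I) = A"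
  by (intro ext) (subst mat_mult_right_unit[where I = I], auto dest: fin_mats_outside)

lemma fin_mats_transpose: "A \<in> fin_mats I \<Longrightarrow> mat_transpose A \<in> fin_mats I"
  unfolding fin_mats_supported supported_def mat_transpose_def mat_unit_def
  by (elim exE) (rule exI, auto)

lemma mat_transpose_mult:
  "mat_transpose (mat_mult A B) = mat_mult (mat_transpose B) (mat_transpose A)"
  by (simp add: mat_transpose_def mat_mult_def mult.commute)

lemma mat_transpose_transpose [simp]: "mat_transpose (mat_transpose A) = A"
  by (simp add: mat_transpose_def)

lemma monoid_fin_mats: "monoid (fin_mat_monoid I)"
  by (rule monoidI)
    (auto simp: fin_mat_monoid_def fin_mats_mult mat_unit_fin_mats mat_mult_assoc
      mat_mult_unit_left mat_mult_unit_right)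

section \<open>The general linear and orthogonal groups\<close>

lemma group_GL_inf: "group (GL_inf \<alpha> k)"
  unfolding GL_inf_def by (rule monoid.units_group[OF monoid_fin_mats])

lemma carrier_GL_inf:
  "A \<in> carrier (GL_inf \<alpha> k) \<longleftrightarrow> A \<in> fin_mats (gl_indices \<alpha> k) \<and>
    (\<exists>B\<in>fin_mats (gl_indices \<alpha> k). mat_mult A B = mat_unit (gl_indices \<alpha> k) \<and>
      mat_mult B A = mat_unit (gl_indices \<alpha> k))"
  by (auto simp: GL_inf_def units_of_def Units_def fin_mat_monoid_def)

lemma mult_GL_inf [simp]: "A \<otimes>\<^bsub>GL_inf \<alpha> k\<^esub> B = mat_mult A B"
  by (simp add: GL_inf_def units_of_def fin_mat_monoid_def)

lemma one_GL_inf [simp]: "\<one>\<^bsub>GL_inf \<alpha> k\<^esub> = mat_unit (gl_indices \<alpha> k)"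
  by (simp add: GL_inf_def units_of_def fin_mat_monoid_def)

lemma O_inf_fin_mats: "u \<in> O_inf \<Longrightarrow> u \<in> fin_mats UNIV"
  by (simp add: O_inf_def)

lemma O_inf_transpose: "u \<in> O_inf \<Longrightarrow> mat_transpose u \<in> O_inf"
  by (simp add: O_inf_def fin_mats_transpose)

lemma O_inf_cancel:
  assumes "u \<in> O_inf" "x \<in> fin_mats UNIV"
  shows "mat_mult u (mat_mult (mat_transpose u) x) = x"
  using assms mat_mult_assoc[of u UNIV "mat_transpose u" x]
  by (simp add: O_inf_def fin_mats_transpose mat_mult_unit_left)

lemma O_inf_mult:
  assumes u: "u \<in> O_inf" and v: "v \<in> O_inf"
  shows "mat_mult u v \<in> O_inf"
proof -
  have *: "mat_mult (mat_mult u v) (mat_transpose (mat_mult u v)) = mat_unit UNIV"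
    if "u \<in> O_inf" "v \<in> O_inf" for u v :: "nat \<Rightarrow> nat \<Rightarrow> 'a padic_int"
  proof -
    note fin = that[THEN O_inf_fin_mats] that[THEN O_inf_transpose, THEN O_inf_fin_mats]
    have "mat_mult (mat_mult u v) (mat_transpose (mat_mult u v)) = mat_mult u (mat_transpose u)"
      by (simp add: mat_transpose_mult mat_mult_assoc[OF fin(1,2)] O_inf_cancel[OF that(2) fin(3)])
    then show ?thesis using that by (simp add: O_inf_def)
  qed
  \<comment> \<open>The second orthogonality relation is the first one for the transposes of v and
    u.\<close>
  have "mat_mult (mat_transpose (mat_mult u v)) (mat_mult u v) = mat_unit UNIV"
    using *[OF v[THEN O_inf_transpose] u[THEN O_inf_transpose]] by (simp add: mat_transpose_mult)
  then show ?thesis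
    using *[OF u v] u v fin_mats_mult unfolding O_inf_def by blast
qed

section \<open>The diagonal embedding\<close>

lemma diag_embed_simps [simp]:
  "diag_embed \<alpha> k u (Inl a) (Inl b) = (if a = b \<and> a < \<alpha> then 1 else 0)"
  "diag_embed \<alpha> k u (Inl a) (Inr y) = 0"
  "diag_embed \<alpha> k u (Inr x) (Inl b) = 0"
  "diag_embed \<alpha> k u (Inr (r, m)) (Inr (s, n)) = (if r = s \<and> r < k then to_fract (u m n) else 0)"
  by (cases y; cases x; simp add: diag_embed_def)+

lemma diag_embed_unit: "diag_embed \<alpha> k (mat_unit UNIV) = mat_unit (gl_indices \<alpha> k)"
proof (intro ext)
  fix i j show "diag_embed \<alpha> k (mat_unit UNIV) i j = mat_unit (gl_indices \<alpha> k) i j"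
    by (cases i; cases j) (auto simp: gl_indices_def mat_unit_def split: if_splits)
qed

text \<open>Every level contains the whole finite block, where embedded matrices act trivially; so
  only the infinite blocks are cut off at n.\<close>

definition level :: "nat \<Rightarrow> nat \<Rightarrow> nat \<Rightarrow> gl_index set" where
  "level \<alpha> k n = {..<\<alpha>} <+> ({..<k} \<times> {..<n})"

text \<open>The part in the finite block is empty because the embedding is the identity there; this
  keeps embedded tails disjoint from levels.\<close>

lemma supported_diag_embed:
  assumes "supported UNIV F u"
  shows "supported (gl_indices \<alpha> k) ({} <+> ({..<k} \<times> F)) (diag_embed \<alpha> k u)"
  unfolding supported_def
proof (intro allI impI)
  have diag: "m \<in> F" if "to_fract (u m m) \<noteq> 1" for m
    using that supportedD[OF assms, of m m] by (cases "m \<in> F") (auto simp: mat_unit_def)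
  fix i j :: gl_index
  assume "i \<notin> {} <+> ({..<k} \<times> F) \<or> j \<notin> {} <+> ({..<k} \<times> F)"
  then show "diag_embed \<alpha> k u i j = mat_unit (gl_indices \<alpha> k) i j"
    by (cases i; cases j)
      (auto simp: gl_indices_def mat_unit_def supportedD[OF assms] intro: diag split: if_splits)
qed

lemma diag_embed_fin_mats:
  assumes "u \<in> fin_mats UNIV"
  shows "diag_embed \<alpha> k u \<in> fin_mats (gl_indices \<alpha> k)"
proof -
  obtain F where F: "finite F" "supported UNIV F u" using assms by (auto simp: fin_mats_supported)
  then show ?thesis
    unfolding fin_mats_supported using supported_diag_embed[OF F(2)]
    by (intro exI[of _ "{} <+> ({..<k} \<times> F)"]) (auto simp: gl_indices_def)
qed

lemma to_fract_sum: "to_fract (sum f S) = (\<Sum>x\<in>S. to_fract (f x))"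
  by (induction S rule: infinite_finite_induct) auto

lemma diag_embed_mult:
  assumes "u \<in> fin_mats UNIV"
  shows "diag_embed \<alpha> k (mat_mult u v) = mat_mult (diag_embed \<alpha> k u) (diag_embed \<alpha> k v)"
proof (intro ext)
  fix i j :: gl_index
  obtain F where F: "finite F" "supported UNIV F u" using assms by (auto simp: fin_mats_supported)
  show "diag_embed \<alpha> k (mat_mult u v) i j = mat_mult (diag_embed \<alpha> k u) (diag_embed \<alpha> k v) i j"
  proof (cases i)
    case (Inl a)
    \<comment> \<open>A row in the finite block is a row of the unit matrix.\<close>
    have "mat_mult (diag_embed \<alpha> k u) (diag_embed \<alpha> k v) i j
      = (if i \<in> gl_indices \<alpha> k then diag_embed \<alpha> k v i j else 0)"
      using supportedD[OF supported_diag_embed[OF F(2)], of i] Inl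
      by (intro mat_mult_left_unit) auto
    then show ?thesis using Inl by (cases j) (auto simp: gl_indices_def)
  next
    case (Inr rm)
    obtain r m where i: "i = Inr (r, m)" using Inr by (cases rm) auto
    define S where "S = insert m F"
    have S: "finite S" "F \<subseteq> S" "m \<in> S" using F by (auto simp: S_def)
    \<comment> \<open>Row (r, m) meets only the r-th copy, so the sum runs over one copy of
      S.\<close>
    have "mat_mult (diag_embed \<alpha> k u) (diag_embed \<alpha> k v) i j
      = (\<Sum>l\<in>(\<lambda>l. Inr (r, l)) ` S. diag_embed \<alpha> k u i l * diag_embed \<alpha> k v l j)"
      unfolding mat_mult_def
    proof (rule Sum_any.expand_superset, safe)
      fix l assume "diag_embed \<alpha> k u i l * diag_embed \<alpha> k v l j \<noteq> 0"
      then have nz: "diag_embed \<alpha> k u i l \<noteq> 0" by auto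
      then obtain n where l: "l = Inr (r, n)" "u m n \<noteq> 0"
        by (cases l) (auto simp: i split: if_splits)
      then have "n \<in> S"
        using S supported_nonzero[OF F(2), of m n] by auto
      then show "l \<in> (\<lambda>l. Inr (r, l)) ` S" using l by simp
    qed (use S in simp)
    also have "\<dots> = (\<Sum>l\<in>S. diag_embed \<alpha> k u i (Inr (r, l)) * diag_embed \<alpha> k v (Inr (r, l)) j)"
      by (subst sum.reindex) (auto simp: inj_on_def)
    also have "\<dots> = diag_embed \<alpha> k (mat_mult u v) i j"
      using S F by (cases j) (auto simp: i mat_mult_sum[of S F] to_fract_sum intro!: sum.neutral)
    finally show ?thesis by simp
  qed
qed

lemma diag_embed_GL:
  assumes "u \<in> O_inf"
  shows "diag_embed \<alpha> k u \<in> carrier (GL_inf \<alpha> k)"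
  using assms unfolding carrier_GL_inf O_inf_def
  by (auto simp: diag_embed_fin_mats fin_mats_transpose diag_embed_mult[symmetric] diag_embed_unit
      intro!: bexI[of _ "diag_embed \<alpha> k (mat_transpose u)"])

lemma mat_unit_O_inf: "(mat_unit UNIV :: nat \<Rightarrow> nat \<Rightarrow> 'a::prime_card padic_int) \<in> O_inf"
proof -
  have "mat_transpose (mat_unit UNIV) = (mat_unit UNIV :: nat \<Rightarrow> nat \<Rightarrow> 'a padic_int)"
    by (auto simp: mat_transpose_def mat_unit_def fun_eq_iff)
  then show ?thesis by (simp add: O_inf_def mat_unit_fin_mats mat_mult_unit_left)
qed

lemma subgroup_K_sub: "subgroup (K_sub \<alpha> k :: 'p::prime_card gl_mat set) (GL_inf \<alpha> k)"
proof (rule group.subgroupI[OF group_GL_inf])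
  show "K_sub \<alpha> k \<subseteq> carrier (GL_inf \<alpha> k)" by (auto simp: K_sub_def diag_embed_GL)
  show "K_sub \<alpha> k \<noteq> ({} :: 'p gl_mat set)" using mat_unit_O_inf by (auto simp: K_sub_def)
next
  fix a :: "'p gl_mat" assume "a \<in> K_sub \<alpha> k"
  then obtain u where u: "u \<in> O_inf" "a = diag_embed \<alpha> k u" by (auto simp: K_sub_def)
  have "mat_mult (diag_embed \<alpha> k (mat_transpose u)) a = mat_unit (gl_indices \<alpha> k)"
    using u by (simp add: diag_embed_mult[symmetric] O_inf_def fin_mats_transpose diag_embed_unit)
  then have "inv\<^bsub>GL_inf \<alpha> k\<^esub> a = diag_embed \<alpha> k (mat_transpose u)"
    using u by (intro group.inv_equality[OF group_GL_inf]) (auto simp: diag_embed_GL O_inf_transpose)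
  then show "inv\<^bsub>GL_inf \<alpha> k\<^esub> a \<in> K_sub \<alpha> k"
    using u by (simp add: K_sub_def O_inf_transpose)
next
  fix a b :: "'p gl_mat" assume "a \<in> K_sub \<alpha> k" "b \<in> K_sub \<alpha> k"
  then obtain u v where "u \<in> O_inf" "v \<in> O_inf" "a = diag_embed \<alpha> k u" "b = diag_embed \<alpha> k v"
    by (auto simp: K_sub_def)
  then show "a \<otimes>\<^bsub>GL_inf \<alpha> k\<^esub> b \<in> K_sub \<alpha> k"
    by (simp add: K_sub_def diag_embed_mult[symmetric] O_inf_fin_mats O_inf_mult)
qed

section \<open>Permutation matrices\<close>

text \<open>The permuted index belongs to the column, so that products follow the order of
  composition.\<close>

definition perm_mat :: "(nat \<Rightarrow> nat) \<Rightarrow> nat \<Rightarrow> nat \<Rightarrow> 'a::comm_ring_1" where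
  "perm_mat \<sigma> = (\<lambda>i j. if i = \<sigma> j then 1 else 0)"

lemma perm_mat_mult:
  "mat_mult (perm_mat \<sigma>) (perm_mat \<tau>) = (perm_mat (\<sigma> \<circ> \<tau>) :: nat \<Rightarrow> nat \<Rightarrow> 'a::comm_ring_1)"
proof (intro ext)
  fix i j
  have "perm_mat \<sigma> i l * (perm_mat \<tau> l j :: 'a) = (if l = \<tau> j then perm_mat (\<sigma> \<circ> \<tau>) i j else 0)" for l
    by (auto simp: perm_mat_def)
  then show "mat_mult (perm_mat \<sigma>) (perm_mat \<tau>) i j = (perm_mat (\<sigma> \<circ> \<tau>) i j :: 'a)"
    by (simp add: mat_mult_def)
qed

lemma perm_mat_id: "perm_mat id = mat_unit UNIV"
  by (auto simp: perm_mat_def mat_unit_def fun_eq_iff)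

lemma mat_mult_perm_mat_right: "mat_mult u (perm_mat \<sigma>) i j = u i (\<sigma> j)"
proof -
  have "u i l * perm_mat \<sigma> l j = (if l = \<sigma> j then u i (\<sigma> j) else 0)" for l
    by (auto simp: perm_mat_def)
  then show ?thesis by (simp add: mat_mult_def)
qed

text \<open>Left multiplication relabels rows by the inverse permutation, which for an involution is
  \<sigma> itself.\<close>

lemma mat_mult_perm_mat_left:
  assumes "\<sigma> \<circ> \<sigma> = id"
  shows "mat_mult (perm_mat \<sigma>) u i j = u (\<sigma> i) j"
proof -
  have "i = \<sigma> l \<longleftrightarrow> l = \<sigma> i" for l
    using assms by (metis comp_apply id_apply)
  then have "perm_mat \<sigma> i l * u l j = (if l = \<sigma> i then u (\<sigma> i) j else 0)" for l
    by (auto simp: perm_mat_def)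
  then show ?thesis by (simp add: mat_mult_def)
qed

text \<open>Injectivity excludes stray ones in a row outside F: a fixed point i is hit by no other
  column.\<close>

lemma supported_perm_mat:
  assumes "inj \<sigma>" "\<And>i. i \<notin> F \<Longrightarrow> \<sigma> i = i"
  shows "supported UNIV F (perm_mat \<sigma>)"
  unfolding supported_def perm_mat_def mat_unit_def
  using assms by simp (metis injD)

text \<open>An involution has a symmetric permutation matrix, so both orthogonality relations say
  that its square is 1.\<close>

lemma perm_mat_O_inf:
  assumes \<sigma>: "\<sigma> \<circ> \<sigma> = id" and "finite F" "\<And>i. i \<notin> F \<Longrightarrow> \<sigma> i = i"
  shows "(perm_mat \<sigma> :: nat \<Rightarrow> nat \<Rightarrow> 'p::prime_card padic_int) \<in> O_inf"
proof -
  have "inj \<sigma>" using \<sigma> by (metis inj_on_id inj_on_imageI2)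
  then have "(perm_mat \<sigma> :: nat \<Rightarrow> nat \<Rightarrow> 'p padic_int) \<in> fin_mats UNIV"
    unfolding fin_mats_supported using assms supported_perm_mat by blast
  moreover have "i = \<sigma> j \<longleftrightarrow> j = \<sigma> i" for i j
    using \<sigma> by (metis comp_apply id_apply)
  then have "mat_transpose (perm_mat \<sigma>) = (perm_mat \<sigma> :: nat \<Rightarrow> nat \<Rightarrow> 'p padic_int)"
    by (auto simp: mat_transpose_def perm_mat_def fun_eq_iff)
  ultimately show ?thesis by (simp add: O_inf_def perm_mat_mult \<sigma> perm_mat_id)
qed

text \<open>One family covers \<open>Theta N\<close> (a = 0, b = n = N) and \<rho> (a = N, b = M).
  The condition \<open>a + n \<le> b\<close> of the lemmas below keeps the two intervals
  disjoint.\<close>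

definition block_swap :: "nat \<Rightarrow> nat \<Rightarrow> nat \<Rightarrow> nat \<Rightarrow> nat" where
  "block_swap a b n = (\<lambda>i. if a \<le> i \<and> i < a + n then i - a + b
     else if b \<le> i \<and> i < b + n then i - b + a else i)"

lemma block_swap_involution: "a + n \<le> b \<Longrightarrow> block_swap a b n \<circ> block_swap a b n = id"
  by (auto simp: block_swap_def fun_eq_iff)

lemma block_swap_O_inf: "a + n \<le> b \<Longrightarrow> perm_mat (block_swap a b n) \<in> O_inf"
  by (rule perm_mat_O_inf[OF block_swap_involution, of _ _ _ "{..<b + n}"])
    (auto simp: block_swap_def)

lemma Theta_perm_mat: "Theta N = perm_mat (block_swap 0 N N)"
  by (auto simp: Theta_def perm_mat_def block_swap_def fun_eq_iff)

lemma Theta_O_inf: "Theta N \<in> O_inf"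
  by (simp add: Theta_perm_mat block_swap_O_inf)

lemma Theta_square: "mat_mult (Theta N) (Theta N) = mat_unit UNIV"
  by (simp add: Theta_perm_mat perm_mat_mult block_swap_involution perm_mat_id)

lemma supported_Theta: "supported UNIV {..<2 * N} (Theta N)"
  by (auto simp: supported_def Theta_def mat_unit_def)

lemma Theta_conj_supported:
  assumes "supported UNIV {..<N} u"
  shows "supported UNIV {N..} (mat_mult (mat_mult (Theta N) u) (Theta N))"
  unfolding supported_def
proof (intro allI impI)
  fix i j assume ij: "i \<notin> {N..} \<or> j \<notin> {N..}"
  define \<sigma> where "\<sigma> = block_swap 0 N N"
  have "\<sigma> \<circ> \<sigma> = id" by (simp add: \<sigma>_def block_swap_involution)
  then have "mat_mult (mat_mult (Theta N) u) (Theta N) i j = u (\<sigma> i) (\<sigma> j)"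
    by (simp add: Theta_perm_mat \<sigma>_def[symmetric] mat_mult_perm_mat_right mat_mult_perm_mat_left)
  \<comment> \<open>An index below N is sent to N or beyond, where u agrees with the unit
    matrix.\<close>
  also have "\<dots> = mat_unit UNIV (\<sigma> i) (\<sigma> j)"
    using ij by (intro supportedD[OF assms]) (auto simp: \<sigma>_def block_swap_def)
  also have "\<dots> = mat_unit UNIV i j"
    using \<open>\<sigma> \<circ> \<sigma> = id\<close> by (simp add: mat_unit_def) (metis comp_apply id_apply)
  finally show "mat_mult (mat_mult (Theta N) u) (Theta N) i j = mat_unit UNIV i j" .
qed

section \<open>Levels and tails\<close>

definition O_tail :: "nat \<Rightarrow> (nat \<Rightarrow> nat \<Rightarrow> ('p::prime_card) padic_int) set" where
  "O_tail n = {u \<in> O_inf. supported UNIV {n..} u}"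

lemma O_tail_swap:
  assumes nN: "n \<le> N" and NM: "N + n \<le> M"
  shows "\<exists>u \<in> (O_tail n :: (nat \<Rightarrow> nat \<Rightarrow> 'p::prime_card padic_int) set).
    mat_mult u u = mat_unit UNIV \<and> mat_mult (mat_mult (Theta M) u) (Theta N) \<in> O_tail n"
proof -
  define \<rho> where "\<rho> = block_swap N M n"
  define \<pi> where "\<pi> = block_swap 0 M M \<circ> \<rho> \<circ> block_swap 0 N N"
  define u :: "nat \<Rightarrow> nat \<Rightarrow> 'p padic_int" where "u = perm_mat \<rho>"
  have \<rho>: "\<rho> \<circ> \<rho> = id" and u: "u \<in> O_inf"
    using NM by (simp_all add: u_def \<rho>_def block_swap_involution block_swap_O_inf)
  have inj: "inj \<sigma>" if "\<sigma> \<circ> \<sigma> = id" for \<sigma> :: "nat \<Rightarrow> nat"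
    using that by (metis inj_on_id inj_on_imageI2)
  \<comment> \<open>Below n, \<rho> does nothing since n \<le> N. Under \<pi> the index travels i, N
    + i, M + i, i.\<close>
  have fix_lt: "\<rho> i = i" "\<pi> i = i" if "i < n" for i
    using that nN NM by (auto simp: \<pi>_def \<rho>_def block_swap_def)
  \<comment> \<open>A composite of three involutions is injective, though \<pi> need not be an
    involution.\<close>
  have inj': "inj \<rho>" "inj \<pi>"
    unfolding \<pi>_def by (intro inj_compose inj \<rho> block_swap_involution; simp)+
  have "supported UNIV {n..} u" and \<pi>: "supported UNIV {n..} (perm_mat \<pi> :: nat \<Rightarrow> nat \<Rightarrow> 'p padic_int)"
    unfolding u_def
    by (intro supported_perm_mat inj' fix_lt; simp)+
  then have tail: "u \<in> O_tail n" using u by (simp add: O_tail_def)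
  have square: "mat_mult u u = mat_unit UNIV"
    by (simp add: u_def perm_mat_mult \<rho> perm_mat_id)
  have "mat_mult (mat_mult (Theta M) u) (Theta N) = perm_mat \<pi>"
    by (simp add: u_def Theta_perm_mat perm_mat_mult \<pi>_def)
  moreover have "mat_mult (mat_mult (Theta M) u) (Theta N) \<in> O_inf"
    by (intro O_inf_mult Theta_O_inf u)
  ultimately have "mat_mult (mat_mult (Theta M) u) (Theta N) \<in> O_tail n"
    using \<pi> by (simp add: O_tail_def)
  then show ?thesis using tail square by blast
qed

section \<open>Verification of the abstract hypotheses\<close>

definition GL_level :: "nat \<Rightarrow> nat \<Rightarrow> nat \<Rightarrow> ('p::prime_card) gl_mat set" where
  "GL_level \<alpha> k n = {g \<in> carrier (GL_inf \<alpha> k). supported (gl_indices \<alpha> k) (level \<alpha> k n) g}"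

lemma GL_level_exhaust:
  assumes "g \<in> carrier (GL_inf \<alpha> k)"
  shows "\<exists>n. g \<in> GL_level \<alpha> k n"
proof -
  obtain F where F: "finite F" "F \<subseteq> gl_indices \<alpha> k" "supported (gl_indices \<alpha> k) F g"
    using assms by (auto simp: carrier_GL_inf fin_mats_supported)
  \<comment> \<open>One more than the largest position in F; the inserted 0 keeps \<open>Max\<close>
    meaningful for empty F.\<close>
  define n where "n = Suc (Max (insert 0 ((\<lambda>i. case i of Inl _ \<Rightarrow> 0 | Inr (r, m) \<Rightarrow> m) ` F)))"
  have "m < n" if "Inr (r, m) \<in> F" for r m
    using F(1) that unfolding n_def less_Suc_eq_le by (intro Max_ge) force+
  then have "F \<subseteq> level \<alpha> k n" using F(2) by (auto simp: gl_indices_def level_def)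
  then have "g \<in> GL_level \<alpha> k n"
    using assms supported_mono[OF F(3)] by (simp add: GL_level_def)
  then show ?thesis ..
qed

text \<open>Since k \<ge> 1, block 0 exists and u can be read off from it. The forward direction
  turns membership in a level into a condition on u, as \<open>\<theta>_conj\<close>
  demands.\<close>

lemma supported_diag_embed_iff:
  assumes "k \<ge> 1"
  shows "supported (gl_indices \<alpha> k) (level \<alpha> k n) (diag_embed \<alpha> k u) \<longleftrightarrow> supported UNIV {..<n} u"
proof
  assume *: "supported (gl_indices \<alpha> k) (level \<alpha> k n) (diag_embed \<alpha> k u)"
  show "supported UNIV {..<n} u"
    unfolding supported_def
  proof (intro allI impI)
    fix i j assume "i \<notin> {..<n} \<or> j \<notin> {..<n}"
    then have "diag_embed \<alpha> k u (Inr (0, i)) (Inr (0, j))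
      = mat_unit (gl_indices \<alpha> k) (Inr (0, i)) (Inr (0, j))"
      by (intro supportedD[OF *]) (auto simp: level_def)
    then have "to_fract (u i j) = to_fract (mat_unit UNIV i j)"
      using assms by (auto simp: mat_unit_def gl_indices_def)
    then show "u i j = mat_unit UNIV i j" by (simp only: to_fract_eq_iff)
  qed
next
  assume "supported UNIV {..<n} u"
  then show "supported (gl_indices \<alpha> k) (level \<alpha> k n) (diag_embed \<alpha> k u)"
    by (rule supported_mono[OF supported_diag_embed]) (auto simp: level_def)
qed

lemma tail_group_GL_inf:
  assumes "k \<ge> 1"
  shows "tail_group (GL_inf \<alpha> k) (K_sub \<alpha> k) (GL_level \<alpha> k)
    (\<lambda>n. diag_embed \<alpha> k ` O_tail n) (\<lambda>N. diag_embed \<alpha> k (Theta N) :: 'p::prime_card gl_mat)"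
proof -
  show ?thesis
  \<comment> \<open>The cases follow the order of the assumptions of \<open>tail_group\<close>; the
    substantial ones are 7 (disjoint supports commute), 11 (conjugation by \<open>Theta N\<close>)
    and 12 (the swap).\<close>
  proof (rule tail_group.intro[OF group_GL_inf], rule tail_group_axioms.intro, goal_cases)
    case 1
    show ?case by (rule subgroup_K_sub)
  next
    case 2
    show ?case by (auto simp: GL_level_def)
  next
    case (3 m n)
    then have "level \<alpha> k m \<subseteq> level \<alpha> k n" by (auto simp: level_def)
    then show ?case by (auto simp: GL_level_def elim: supported_mono)
  next
    case (4 x)
    then show ?case by (rule GL_level_exhaust)
  next
    case (5 x n y)
    then have "x \<otimes>\<^bsub>GL_inf \<alpha> k\<^esub> y \<in> carrier (GL_inf \<alpha> k)" 
      by (intro monoid.m_closed[OF group.is_monoid[OF group_GL_inf]]) (auto simp: GL_level_def)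
    with 5 show ?case by (simp add: GL_level_def supported_mult)
  next
    case (6 n)
    show ?case by (auto simp: K_sub_def O_tail_def)
  next
    case (7 t n x)
    then obtain u where u: "u \<in> O_inf" "supported UNIV {n..} u" "t = diag_embed \<alpha> k u"
      by (auto simp: O_tail_def)
    have "mat_mult t x = mat_mult x t"
    proof (rule supported_disjoint_commute)
      show "supported (gl_indices \<alpha> k) ({} <+> ({..<k} \<times> {n..})) t"
        using u by (simp add: supported_diag_embed)
      show "supported (gl_indices \<alpha> k) (level \<alpha> k n) x" using 7 by (simp add: GL_level_def)
      show "({} <+> ({..<k} \<times> {n..})) \<inter> level \<alpha> k n = {}" by (auto simp: level_def)
      have mem: "t \<in> fin_mats (gl_indices \<alpha> k)" "x \<in> fin_mats (gl_indices \<alpha> k)"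
        using u 7 by (auto simp: diag_embed_fin_mats O_inf_fin_mats GL_level_def carrier_GL_inf)
      show "t i j = 0" "x i j = 0" if "i \<notin> gl_indices \<alpha> k \<or> j \<notin> gl_indices \<alpha> k" for i j
        by (rule fin_mats_outside[OF mem(1) that] fin_mats_outside[OF mem(2) that])+
    qed
    then show ?case by simp
  next
    case (8 N)
    show ?case by (simp add: K_sub_def Theta_O_inf)
  next
    case (9 N)
    show ?case
      using assms
      by (simp add: GL_level_def diag_embed_GL Theta_O_inf supported_diag_embed_iff supported_Theta)
  next
    case (10 N)
    show ?case
      by (simp add: diag_embed_mult[symmetric] O_inf_fin_mats Theta_O_inf Theta_square diag_embed_unit)
  next
    case (11 x N)
    then obtain u where u: "u \<in> O_inf" "x = diag_embed \<alpha> k u" by (auto simp: K_sub_def)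
    with 11 assms have "supported UNIV {..<N} u"
      by (simp add: GL_level_def supported_diag_embed_iff)
    then have "mat_mult (mat_mult (Theta N) u) (Theta N) \<in> O_tail N"
      using u by (simp add: O_tail_def Theta_conj_supported O_inf_mult Theta_O_inf)
    moreover have "diag_embed \<alpha> k (Theta N) \<otimes>\<^bsub>GL_inf \<alpha> k\<^esub> x \<otimes>\<^bsub>GL_inf \<alpha> k\<^esub> diag_embed \<alpha> k (Theta N)
      = diag_embed \<alpha> k (mat_mult (mat_mult (Theta N) u) (Theta N))"
      using u by (simp add: diag_embed_mult O_inf_fin_mats fin_mats_mult Theta_O_inf)
    ultimately show ?case by simp
  next
    case (12 n N M)
    then obtain u where u: "u \<in> (O_tail n :: (nat \<Rightarrow> nat \<Rightarrow> 'p padic_int) set)"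
      and "mat_mult u u = mat_unit UNIV"
      and "mat_mult (mat_mult (Theta M) u) (Theta N) \<in> O_tail n"
      using O_tail_swap by blast
    moreover have "u \<in> O_inf" using u by (simp add: O_tail_def)
    ultimately show ?case
      by (intro bexI[of _ "diag_embed \<alpha> k u"])
        (auto simp: diag_embed_mult[symmetric] diag_embed_unit O_inf_fin_mats O_inf_mult Theta_O_inf)
  qed
qed

section \<open>Transfer to double cosets of the p-adic group\<close>

theorem theorem2p1:
  fixes \<alpha> k :: nat
  assumes "k \<ge> 1"
  shows
    "(\<forall>A \<in> (dcosets \<alpha> k :: 'p::prime_card gl_mat set set). \<forall>B \<in> dcosets \<alpha> k.
        \<forall>g \<in> A. \<forall>h \<in> B. eventually_constant (dcoset_seq \<alpha> k g h)) \<and>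
     (\<forall>A \<in> (dcosets \<alpha> k :: 'p gl_mat set set). \<forall>B \<in> dcosets \<alpha> k.
        \<forall>g \<in> A. \<forall>g' \<in> A. \<forall>h \<in> B. \<forall>h' \<in> B.
          eventual_value (dcoset_seq \<alpha> k g h) = eventual_value (dcoset_seq \<alpha> k g' h')) \<and>
     (\<forall>A \<in> (dcosets \<alpha> k :: 'p gl_mat set set). \<forall>B \<in> dcosets \<alpha> k.
        dcoset_prod \<alpha> k A B \<in> dcosets \<alpha> k) \<and>
     (\<forall>A \<in> (dcosets \<alpha> k :: 'p gl_mat set set). \<forall>B \<in> dcosets \<alpha> k. \<forall>C \<in> dcosets \<alpha> k.
        dcoset_prod \<alpha> k (dcoset_prod \<alpha> k A B) C = dcoset_prod \<alpha> k A (dcoset_prod \<alpha> k B C))"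
proof -
  interpret tail_group "GL_inf \<alpha> k :: 'p gl_mat monoid" "K_sub \<alpha> k" "GL_level \<alpha> k"
    "\<lambda>n. diag_embed \<alpha> k ` O_tail n" "\<lambda>N. diag_embed \<alpha> k (Theta N)"
    by (rule tail_group_GL_inf[OF assms])
  have dc: "dcoset \<alpha> k = dc"
    by (intro ext) (simp add: dcoset_def dc_def)
  have seq: "dcoset_seq \<alpha> k = dc_seq"
    by (intro ext) (simp only: dcoset_seq_def dc_seq_def dc)
  have prod: "dcoset_prod \<alpha> k = dc_prod"
    by (intro ext) (simp only: dcoset_prod_def dc_prod_def seq)
  have cosets: "dcosets \<alpha> k = dc ` carrier (GL_inf \<alpha> k)"
    by (simp only: dcosets_def dc)
  show ?thesis
    unfolding seq prod cosets
  proof (intro conjI ballI)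
    fix A B g h
    assume "A \<in> dc ` carrier (GL_inf \<alpha> k)" "B \<in> dc ` carrier (GL_inf \<alpha> k)" "g \<in> A" "h \<in> B"
    then show "eventually_constant (dc_seq g h)"
      by (auto intro!: eventually_constant_dc_seq dest: dc_carrier[rotated])
  next
    fix A B g g' h h'
    assume "A \<in> dc ` carrier (GL_inf \<alpha> k)" "B \<in> dc ` carrier (GL_inf \<alpha> k)"
      and gh: "g \<in> A" "g' \<in> A" "h \<in> B" "h' \<in> B"
    \<comment> \<open>Both pairs of representatives are compared with one fixed pair a, b generating
      the double cosets.\<close>
    then obtain a b where "a \<in> carrier (GL_inf \<alpha> k)" "b \<in> carrier (GL_inf \<alpha> k)"
      and "A = dc a" "B = dc b"
      by auto
    then show "eventual_value (dc_seq g h) = eventual_value (dc_seq g' h')"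
      using gh by (simp add: eventual_value_indep[of a b])
  qed (rule dc_prod_closed dc_prod_assoc; assumption)+
qed

end
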